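(* Let $G$ be a finite connected simple graph with $n$ vertices and $m$ edges. Let $L$ be its Laplace matrix, $M$ its matrix of transition probabilities, and $N=I-M$. For a vertex $v$, let $L_v$ and $N_v$ be the matrices obtained from $L$ and $N$ by deleting the row and column corresponding to $v$. Then, with eigenvalues counted with algebraic multiplicity, 1. $K(G) = n \sum_{\lambda} \frac{1}{\lambda}$, the sum over the nonzero eigenvalues $\lambda$ of $L$; 2. $K_{\pi^2}(G) = 2m \sum_{\lambda} \frac{1}{\lambda}$, the sum over the nonzero eigenvalues $\lambda$ of $N$; 3. $R(v) = \sum_{\lambda} \frac{1}{\lambda}$, the sum over all eigenvalues $\lambda$ of $L_v$; 4. $R_{\pi}(v) = \sum_{\lambda} \frac{1}{\lambda}$, the sum over all eigenvalues $\lambda$ of $N_v$.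
   Context: $L = \mathrm{Deg} - A$ where $A$ is the adjacency matrix and $\mathrm{Deg}$ the diagonal degree matrix. $M$ has entries $m_{ij}=1/d(i)$ if $ij$ is an edge and $0$ otherwise, where $d(i)$ is the degree. $r(v,w)$ is the effective resistance between $v$ and $w$ with each edge a unit resistor. $K(G)=\sum_{\{x,y\}\subseteq V(G)} r(x,y)$, $K_{\pi^2}(G)=\frac12\sum_x\sum_y d(x)d(y)r(x,y)$, $R(v)=\sum_w r(v,w)$, $R_\pi(v)=\sum_w d(w)r(v,w)$, sums over $V(G)$. *)

theory Defs
  imports
    Complex_Main
    "Graph_Theory.Digraph_Component"
    "Jordan_Normal_Form.Char_Poly"
begin

text \<open>
  A finite simple graph is a \<open>pair_graph\<close>: a finite vertex set with an irreflexive symmetric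
  set of ordered pairs, so each undirected edge occurs as two arcs.
\<close>

definition edge_set :: "'a pair_pre_digraph \<Rightarrow> 'a set set" where
  "edge_set G = {{x, y} |x y. (x, y) \<in> parcs G}"

abbreviation deg :: "'a pair_pre_digraph \<Rightarrow> 'a \<Rightarrow> nat" where
  "deg G x \<equiv> out_degree (with_proj G) x"

text \<open>
  Potentials of a unit current from \<open>v\<close> to \<open>w\<close>. By Ohm's law, the current through the unit
  resistor \<open>xy\<close> is \<open>h x - h y\<close>; by Kirchhoff's current law, the net current leaving \<open>x\<close>
  is \<open>1\<close> at \<open>v\<close>, \<open>-1\<close> at \<open>w\<close> and \<open>0\<close> elsewhere (everywhere \<open>0\<close> if \<open>v = w\<close>).
\<close>

definition unit_current_potential ::
    "'a pair_pre_digraph \<Rightarrow> 'a \<Rightarrow> 'a \<Rightarrow> ('a \<Rightarrow> real) \<Rightarrow> bool" where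
  "unit_current_potential G v w h \<longleftrightarrow>
     (\<forall>x\<in>pverts G. (\<Sum>y | (x, y) \<in> parcs G. h x - h y) = of_bool (x = v) - of_bool (x = w))"

text \<open>
  The potential difference needed to drive a unit current from \<open>v\<close> to \<open>w\<close>; in a connected
  graph, the potential exists and is unique up to an additive constant.
\<close>

definition eff_resistance :: "'a pair_pre_digraph \<Rightarrow> 'a \<Rightarrow> 'a \<Rightarrow> real" where
  "eff_resistance G v w = (THE r. \<exists>h. unit_current_potential G v w h \<and> r = h v - h w)"

text \<open>
  The sum ranges over unordered pairs; the description is well defined since effective
  resistance is symmetric.
\<close>

definition kirchhoff_index :: "'a pair_pre_digraph \<Rightarrow> real" where
  "kirchhoff_index G =
     (\<Sum>e | e \<subseteq> pverts G \<and> card e = 2. THE r. \<exists>x y. e = {x, y} \<and> r = eff_resistance G x y)"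

definition mult_degree_kirchhoff_index :: "'a pair_pre_digraph \<Rightarrow> real" where
  "mult_degree_kirchhoff_index G =
     1 / 2 * (\<Sum>x\<in>pverts G. \<Sum>y\<in>pverts G.
       real (deg G x) * real (deg G y) * eff_resistance G x y)"

definition vertex_resistance :: "'a pair_pre_digraph \<Rightarrow> 'a \<Rightarrow> real" where
  "vertex_resistance G v = (\<Sum>w\<in>pverts G. eff_resistance G v w)"

definition degree_vertex_resistance :: "'a pair_pre_digraph \<Rightarrow> 'a \<Rightarrow> real" where
  "degree_vertex_resistance G v = (\<Sum>w\<in>pverts G. real (deg G w) * eff_resistance G v w)"

text \<open>
  Rows and columns are indexed by positions in an enumeration \<open>vs\<close> of the vertices. The entries
  are taken in \<open>\<complex>\<close> so that \<open>eigenvalue\<close> covers all eigenvalues; no realness is presupposed.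
\<close>

definition adjacency_mat :: "'a pair_pre_digraph \<Rightarrow> 'a list \<Rightarrow> complex mat" where
  "adjacency_mat G vs =
     mat (length vs) (length vs) (\<lambda>(i, j). if (vs ! i, vs ! j) \<in> parcs G then 1 else 0)"

definition degree_mat :: "'a pair_pre_digraph \<Rightarrow> 'a list \<Rightarrow> complex mat" where
  "degree_mat G vs =
     mat (length vs) (length vs) (\<lambda>(i, j). if i = j then of_nat (deg G (vs ! i)) else 0)"

definition laplace_mat :: "'a pair_pre_digraph \<Rightarrow> 'a list \<Rightarrow> complex mat" where
  "laplace_mat G vs = degree_mat G vs - adjacency_mat G vs"

definition transition_mat :: "'a pair_pre_digraph \<Rightarrow> 'a list \<Rightarrow> complex mat" where
  "transition_mat G vs =
     mat (length vs) (length vs)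
       (\<lambda>(i, j). if (vs ! i, vs ! j) \<in> parcs G then 1 / of_nat (deg G (vs ! i)) else 0)"

definition alg_mult :: "complex mat \<Rightarrow> complex \<Rightarrow> nat" where
  "alg_mult A \<mu> = Polynomial.order \<mu> (char_poly A)"

end

theory Submission
  imports Defs
begin

text \<open>
  For a monic complex polynomial \<open>p\<close> with \<open>p 0 \<noteq> 0\<close>, the sum of the reciprocals of its roots is
  \<open>- p' 0 / p 0\<close>, and the derivative of a characteristic polynomial is the sum of the
  characteristic polynomials of the matrices obtained by deleting one row and the same column.
  Hence the sum over the eigenvalues of \<open>L\<^sub>v\<close> is a quotient of minors which, by Cramer's rule, is
  the sum of the potentials that define the resistances \<open>r(v, w)\<close>. The same argument works for
  \<open>N\<^sub>v\<close>, whose rows are those of \<open>L\<^sub>v\<close> divided by the degrees. For \<open>L\<close> and \<open>N\<close> themselves, the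
  sum is \<open>- p'' 0 / (2 * p' 0)\<close>, where both derivatives are sums over \<open>v\<close> of the quantities for
  the reduced matrices; their determinants are all equal for \<open>L\<close> and proportional to the degree
  of \<open>v\<close> for \<open>N\<close>, so the resistance sums of the single vertices add up to the Kirchhoff indices.
\<close>

section \<open>Reciprocals of eigenvalues and principal minors\<close>

text \<open>Logarithmic derivative at 0: by the product rule, \<open>p' / p\<close> is the sum of
  \<open>order z p / (X - z)\<close> over the roots \<open>z\<close>, and evaluation at 0 negates
  the reciprocals.\<close>

lemma sum_order_div_roots:
  fixes p :: "complex poly"
  assumes "poly p 0 \<noteq> 0"
  shows "(\<Sum>z | poly p z = 0. of_nat (order z p) * (1 / z)) = - poly (pderiv p) 0 / poly p 0"
proof -
  define Z where "Z = {z. poly p z = 0}"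
  define f where "f z = [:- z, 1:] ^ order z p" for z :: complex
  have p: "p \<noteq> 0"
    using assms by auto
  have fin: "finite Z"
    using poly_roots_finite[OF p] by (simp add: Z_def)
  obtain c where dec: "p = Polynomial.smult c (prod f Z)"
    using that[OF complex_poly_decompose[of p, symmetric, folded Z_def f_def]] .
  have nz: "z \<noteq> 0" if "z \<in> Z" for z
    using that assms by (auto simp: Z_def)
  have fnz: "poly (f z) 0 \<noteq> 0" if "z \<in> Z" for z
    using nz[OF that] by (simp add: f_def poly_power)
  have term_eq: "poly (prod f (Z - {z}) * pderiv (f z)) 0
      = - poly (prod f Z) 0 * (of_nat (order z p) * (1 / z))" if z: "z \<in> Z" for z
  proof -
    obtain k where k: "order z p = Suc k"
      using z p by (cases "order z p") (auto simp: Z_def order_root)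
    have "poly (prod f Z) 0 = poly (f z) 0 * poly (prod f (Z - {z})) 0"
      by (simp add: prod.remove[OF fin z])
    moreover have "poly (pderiv (f z)) 0 = - poly (f z) 0 * (of_nat (order z p) * (1 / z))"
      unfolding f_def k pderiv_power_Suc
      using nz[OF z] by (simp add: pderiv_pCons poly_power field_simps)
    ultimately show ?thesis
      by simp
  qed
  have "poly (pderiv (prod f Z)) 0
      = - poly (prod f Z) 0 * (\<Sum>z\<in>Z. of_nat (order z p) * (1 / z))"
    by (simp only: pderiv_prod poly_sum sum_distrib_left)
       (rule sum.cong[OF refl], rule term_eq)
  moreover have "poly p 0 = c * poly (prod f Z) 0"
    by (subst dec) simp
  moreover have "poly (pderiv p) 0 = c * poly (pderiv (prod f Z)) 0"
    by (subst dec) (simp add: pderiv_smult)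
  ultimately have "poly (pderiv p) 0 = - poly p 0 * (\<Sum>z\<in>Z. of_nat (order z p) * (1 / z))"
    by simp
  then show ?thesis
    using assms by (simp add: Z_def)
qed

text \<open>The nonvanishing derivative makes 0 a simple root: \<open>p = X * q\<close> with
  \<open>q 0 = p' 0\<close> and \<open>q' 0 = p'' 0 / 2\<close>. The roots of \<open>q\<close> are
  the nonzero roots of \<open>p\<close>, with the same orders, so the previous formula applies to
  \<open>q\<close>.\<close>

lemma sum_order_div_nonzero_roots:
  fixes p :: "complex poly"
  assumes "poly p 0 = 0" and "poly (pderiv p) 0 \<noteq> 0"
  shows "(\<Sum>z | poly p z = 0 \<and> z \<noteq> 0. of_nat (order z p) * (1 / z))
    = - poly (pderiv (pderiv p)) 0 / (2 * poly (pderiv p) 0)"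
proof -
  obtain q where q: "p = [:0, 1:] * q"
    using assms(1) by (metis dvdE minus_zero poly_eq_0_iff_dvd)
  have p': "pderiv p = q + [:0, 1:] * pderiv q"
    unfolding q by (subst pderiv_mult) (simp add: pderiv_pCons)
  have q0: "poly q 0 = poly (pderiv p) 0"
    by (simp add: p')
  have q1: "poly (pderiv (pderiv p)) 0 = 2 * poly (pderiv q) 0"
    unfolding p' by (simp add: pderiv_add pderiv_mult pderiv_pCons del: mult_pCons_left)
  have ord: "order z p = order z q" if "z \<noteq> 0" for z
  proof -
    have "p \<noteq> 0"
      using assms(2) by auto
    then show ?thesis
      using that unfolding q by (subst order_mult) (auto intro: order_0I simp del: mult_pCons_left)
  qed
  have "{z. poly p z = 0 \<and> z \<noteq> 0} = {z. poly q z = 0}"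
    using q0 assms(2) by (auto simp: q)
  then have "(\<Sum>z | poly p z = 0 \<and> z \<noteq> 0. of_nat (order z p) * (1 / z))
      = (\<Sum>z | poly q z = 0. of_nat (order z q) * (1 / z))"
    using q0 assms(2) ord by (intro sum.cong) auto
  then show ?thesis
    using sum_order_div_roots[of q] q0 q1 assms(2) by simp
qed

section \<open>Derivatives of determinants and characteristic polynomials\<close>

lemma det_unit_row:
  fixes A :: "'a :: comm_ring_1 mat"
  assumes A: "A \<in> carrier_mat n n" and k: "k < n"
    and row: "\<And>j. j < n \<Longrightarrow> A $$ (k, j) = of_bool (j = k)"
  shows "det A = det (mat_delete A k k)"
proof -
  have "det A = (\<Sum>j<n. of_bool (j = k) * cofactor A k j)"
    using laplace_expansion_row[OF A k] row by simp
  also have "\<dots> = (\<Sum>j<n. if k = j then cofactor A k j else 0)"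
    by (rule sum.cong) auto
  also have "\<dots> = cofactor A k k"
    using k by (simp only: sum.delta' finite_lessThan) simp
  \<comment> \<open>The cofactor at \<open>(k, k)\<close> has sign
    \<open>(-1) ^ (k + k) = 1\<close>.\<close>
  finally show ?thesis
    by (simp add: cofactor_def flip: mult_2)
qed

lemma pderiv_signof_mult:
  "pderiv (signof p * q) = signof p * pderiv (q :: 'a :: idom poly)"
  by (cases p rule: sign_cases) (simp_all add: pderiv_minus)

text \<open>The product rule differentiates one factor of each term of the Leibniz formula, that is,
  one row at a time. Exchanging the two sums collects the terms by row.\<close>

lemma pderiv_det:
  fixes A :: "'a :: idom poly mat"
  assumes A: "A \<in> carrier_mat n n"
  shows "pderiv (det A)
    = (\<Sum>k<n. det (mat n n (\<lambda>(i, j). if i = k then pderiv (A $$ (i, j)) else A $$ (i, j))))"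
proof -
  let ?D = "\<lambda>k. mat n n (\<lambda>(i, j). if i = k then pderiv (A $$ (i, j)) else A $$ (i, j))"
  have rows: "(\<Prod>i = 0..<n. ?D k $$ (i, \<pi> i))
      = (\<Prod>i\<in>{0..<n} - {k}. A $$ (i, \<pi> i)) * pderiv (A $$ (k, \<pi> k))"
    if "\<pi> permutes {0..<n}" and k: "k \<in> {0..<n}" for \<pi> k
  proof -
    have less: "\<pi> i < n" if "i < n" for i
      using permutes_in_image[OF \<open>\<pi> permutes {0..<n}\<close>, of i] that by simp
    have "(\<Prod>i\<in>{0..<n} - {k}. ?D k $$ (i, \<pi> i)) = (\<Prod>i\<in>{0..<n} - {k}. A $$ (i, \<pi> i))"
      by (rule prod.cong) (use less in auto)
    then show ?thesis
      using k less by (subst prod.remove[OF _ k]) (auto simp: mult.commute)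
  qed
  have "pderiv (det A) = (\<Sum>\<pi> | \<pi> permutes {0..<n}. \<Sum>k<n.
      signof \<pi> * (\<Prod>i = 0..<n. ?D k $$ (i, \<pi> i)))"
    \<comment> \<open>The rule for iterated derivatives of sums, taken at order one, is the
      additivity of \<open>pderiv\<close>.\<close>
    unfolding det_def'[OF A] higher_pderiv_sum[of 1, simplified] pderiv_signof_mult pderiv_prod
    unfolding sum_distrib_left atLeast0LessThan[symmetric]
    by (intro sum.cong refl arg_cong2[of _ _ _ _ "(*)"] rows[symmetric]) simp_all
  also have "\<dots> = (\<Sum>k<n. det (?D k))"
    by (subst sum.swap) (simp add: det_def'[of "?D _" n])
  finally show ?thesis .
qed

lemma mat_delete_char_poly_matrix:
  assumes "A \<in> carrier_mat n n" and "k < n"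
  shows "mat_delete (char_poly_matrix A) k k = char_poly_matrix (mat_delete A k k)"
  using assms by (intro eq_matI) (auto simp: mat_delete_def char_poly_matrix_def)

text \<open>Differentiating row \<open>k\<close> of \<open>X * I - A\<close> leaves the
  \<open>k\<close>-th unit row, so the determinant with that row collapses to the characteristic
  polynomial of the principal submatrix.\<close>

lemma pderiv_char_poly:
  fixes A :: "'a :: idom mat"
  assumes A: "A \<in> carrier_mat n n"
  shows "pderiv (char_poly A) = (\<Sum>k<n. char_poly (mat_delete A k k))"
proof -
  let ?C = "char_poly_matrix A"
  let ?D = "\<lambda>k. mat n n (\<lambda>(i, j). if i = k then pderiv (?C $$ (i, j)) else ?C $$ (i, j))"
  have C: "?C \<in> carrier_mat n n"
    using A by simp
  have "det (?D k) = char_poly (mat_delete A k k)" if k: "k < n" for k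
  proof -
    have "?D k $$ (k, j) = of_bool (j = k)" if "j < n" for j
      using that k A by (auto simp: char_poly_matrix_def pderiv_pCons)
    then have "det (?D k) = det (mat_delete (?D k) k k)"
      using k by (intro det_unit_row) auto
    also have "mat_delete (?D k) k k = mat_delete ?C k k"
      using k C by (intro eq_matI) (auto simp: mat_delete_def)
    finally show ?thesis
      using A k by (simp add: char_poly_def mat_delete_char_poly_matrix)
  qed
  then show ?thesis
    unfolding char_poly_def[of A] pderiv_det[OF C] by simp
qed

lemma poly_char_poly_0:
  fixes A :: "'a :: field mat"
  assumes A: "A \<in> carrier_mat n n"
  shows "poly (char_poly A) 0 = (- 1) ^ n * det A"
proof -
  have "- char_matrix A 0 = (- 1) \<cdot>\<^sub>m A"
    using A by (intro eq_matI) (auto simp: char_matrix_def)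
  then show ?thesis
    using A by (simp add: char_poly_matrix[OF A])
qed

lemma sum_reciprocal_eigenvalues:
  assumes A: "A \<in> carrier_mat n n" and det: "det A \<noteq> 0"
  shows "(\<Sum>\<mu> | eigenvalue A \<mu>. of_nat (alg_mult A \<mu>) * (1 / \<mu>))
    = (\<Sum>i<n. det (mat_delete A i i)) / det A"
\<comment> \<open>For \<open>n = 0\<close> both sides are 0. This case arises for the reduced
  matrices of the one-vertex graph; for \<open>n > 0\<close> the signs \<open>(-1) ^ (n - 1)\<close>
  and \<open>(-1) ^ n\<close> cancel the minus sign of the logarithmic derivative.\<close>
proof (cases n)
  case 0
  then have "{\<mu>. eigenvalue A \<mu>} = {}"
    using eigenvalue_imp_nonzero_dim[OF A] by auto
  then show ?thesis
    using 0 by simp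
next
  case (Suc l)
  have "poly (char_poly (mat_delete A i i)) 0 = (- 1) ^ l * det (mat_delete A i i)" for i
    using mat_delete_carrier[OF A, of i i] Suc by (intro poly_char_poly_0) simp
  then have "poly (pderiv (char_poly A)) 0 = (- 1) ^ l * (\<Sum>i<n. det (mat_delete A i i))"
    by (simp add: pderiv_char_poly[OF A] poly_sum sum_distrib_left)
  then show ?thesis
    using det sum_order_div_roots[of "char_poly A"] Suc
    by (simp add: eigenvalue_root_char_poly[OF A] alg_mult_def poly_char_poly_0[OF A])
qed

text \<open>The first derivative of the characteristic polynomial is the sum of those of the
  principal submatrices, and the second is the sum of their derivatives. Expressing the latter at 0
  by reciprocal sums, instead of by smaller minors, lets the results for single vertices be reused
  for the whole matrix.\<close>

lemma sum_reciprocal_nonzero_eigenvalues: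
  assumes A: "A \<in> carrier_mat n n" and det: "det A = 0"
    and minors: "\<And>i. i < n \<Longrightarrow> det (mat_delete A i i) \<noteq> 0"
    and sum_minors: "(\<Sum>i<n. det (mat_delete A i i)) \<noteq> 0"
  shows "(\<Sum>\<mu> | eigenvalue A \<mu> \<and> \<mu> \<noteq> 0. of_nat (alg_mult A \<mu>) * (1 / \<mu>))
    = (\<Sum>i<n. det (mat_delete A i i) * (\<Sum>\<mu> | eigenvalue (mat_delete A i i) \<mu>.
         of_nat (alg_mult (mat_delete A i i) \<mu>) * (1 / \<mu>)))
      / (2 * (\<Sum>i<n. det (mat_delete A i i)))"
proof -
  let ?B = "\<lambda>i. mat_delete A i i"
  define T where "T i = (\<Sum>\<mu> | eigenvalue (?B i) \<mu>. of_nat (alg_mult (?B i) \<mu>) * (1 / \<mu>))" for i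
  let ?s = "(- 1 :: complex) ^ (n - 1)"
  note B = mat_delete_carrier[OF A]
  have p0: "poly (char_poly (?B i)) 0 = ?s * det (?B i)" for i
    by (rule poly_char_poly_0[OF B])
  have p1: "poly (pderiv (char_poly (?B i))) 0 = - ?s * (det (?B i) * T i)" if "i < n" for i
    using minors[OF that] p0[of i] sum_order_div_roots[of "char_poly (?B i)"]
    by (simp add: T_def eigenvalue_root_char_poly[OF B] alg_mult_def)
  have "poly (pderiv (char_poly A)) 0 = ?s * (\<Sum>i<n. det (?B i))"
    by (simp add: pderiv_char_poly[OF A] poly_sum sum_distrib_left p0)
  moreover have "poly (pderiv (pderiv (char_poly A))) 0 = - ?s * (\<Sum>i<n. det (?B i) * T i)"
    by (simp only: pderiv_char_poly[OF A] higher_pderiv_sum[of 1, simplified] poly_sum sum_distrib_left)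
       (rule sum.cong, use p1 in auto)
  ultimately show ?thesis
    using sum_order_div_nonzero_roots[of "char_poly A"] sum_minors
    by (simp add: eigenvalue_root_char_poly[OF A] alg_mult_def poly_char_poly_0[OF A] det T_def)
qed

section \<open>Harmonic functions and effective resistance\<close>

text \<open>Each unordered pair comes from exactly two ordered ones, distinct by irreflexivity. This
  serves both the handshake lemma and the Kirchhoff index.\<close>

lemma sum_symmetric_pairs:
  fixes f :: "'a \<Rightarrow> 'a \<Rightarrow> 'b :: comm_semiring_1"
  assumes "finite R" and "irrefl R" and "sym R"
    and g: "\<And>x y. (x, y) \<in> R \<Longrightarrow> g {x, y} = f x y"
  shows "(\<Sum>(x, y)\<in>R. f x y) = 2 * (\<Sum>e\<in>{{x, y} |x y. (x, y) \<in> R}. g e)"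
proof -
  let ?\<phi> = "\<lambda>(x, y). {x, y}"
  have "(\<Sum>(x, y)\<in>R. f x y) = (\<Sum>e\<in>?\<phi> ` R. \<Sum>(x, y) | (x, y) \<in> R \<and> {x, y} = e. f x y)"
    by (subst sum.image_gen[OF \<open>finite R\<close>, of _ ?\<phi>])
       (intro sum.cong refl, auto)
  also have "\<dots> = (\<Sum>e\<in>?\<phi> ` R. 2 * g e)"
  proof (rule sum.cong[OF refl])
    fix e assume "e \<in> ?\<phi> ` R"
    then obtain x y where xy: "(x, y) \<in> R" and e: "e = {x, y}"
      by auto
    have yx: "(y, x) \<in> R" and "x \<noteq> y"
      using xy assms(2,3) by (auto simp: irrefl_def sym_def)
    have "{(x', y'). (x', y') \<in> R \<and> {x', y'} = e} = {(x, y), (y, x)}"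
      using xy yx by (auto simp: e doubleton_eq_iff)
    then have "(\<Sum>(x, y) | (x, y) \<in> R \<and> {x, y} = e. f x y) = f x y + f y x"
      using \<open>x \<noteq> y\<close> by simp
    also have "\<dots> = 2 * g e"
      using g[OF xy] g[OF yx] by (simp add: e insert_commute mult_2)
    finally show "(\<Sum>(x, y) | (x, y) \<in> R \<and> {x, y} = e. f x y) = 2 * g e" .
  qed
  also have "?\<phi> ` R = {{x, y} |x y. (x, y) \<in> R}"
    by auto
  finally show ?thesis
    by (simp add: sum_distrib_left)
qed

text \<open>The graph Laplacian acting on functions on the vertices, polymorphic so that it applies
  both to real potentials and to complex vectors.\<close>

definition lap :: "'a pair_pre_digraph \<Rightarrow> ('a \<Rightarrow> 'b :: ab_group_add) \<Rightarrow> 'a \<Rightarrow> 'b" where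
  "lap G h x = (\<Sum>y | (x, y) \<in> parcs G. h x - h y)"

definition lap_entry :: "'a pair_pre_digraph \<Rightarrow> 'a \<Rightarrow> 'a \<Rightarrow> complex" where
  "lap_entry G x y = (if x = y then of_nat (deg G x) else 0) - of_bool ((x, y) \<in> parcs G)"

lemma lap_uminus: "lap G (\<lambda>x. - h x) x = - lap G h x"
  by (simp add: lap_def flip: sum_negf)

lemma lap_diff: "lap G (\<lambda>x. h x - h' x) x = lap G h x - lap G h' x"
  unfolding lap_def sum_subtractf[symmetric] by (rule sum.cong) auto

lemma Re_lap: "Re (lap G h x) = lap G (\<lambda>y. Re (h y)) x"
  by (simp add: lap_def)

lemma Im_lap: "Im (lap G h x) = lap G (\<lambda>y. Im (h y)) x"
  by (simp add: lap_def)

lemma lap_const: "lap G (\<lambda>_. c) x = 0"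
  by (simp add: lap_def)

lemma unit_current_potential_altdef:
  "unit_current_potential G v w h \<longleftrightarrow>
    (\<forall>x\<in>pverts G. lap G h x = of_bool (x = v) - of_bool (x = w))"
  by (simp add: unit_current_potential_def lap_def)

locale connected_pair_graph = pair_graph G for G :: "'a pair_pre_digraph" +
  assumes connected: "Digraph_Component.connected (with_proj G)"
begin

lemma arc_sym: "(x, y) \<in> parcs G \<longleftrightarrow> (y, x) \<in> parcs G"
  using pair_sym_arcs by (auto simp: symmetric_def sym_def)

lemma no_loop: "(x, x) \<notin> parcs G"
  using pair_no_loops by fastforce

lemma arc_verts: "(x, y) \<in> parcs G \<Longrightarrow> x \<in> pverts G \<and> y \<in> pverts G"
  using arc_fst_in_verts arc_snd_in_verts by fastforce

lemma finite_neighbours: "finite {y. (x, y) \<in> parcs G}"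
  by (rule finite_subset[OF _ pair_finite_verts]) (use arc_verts in blast)

lemma deg_eq_card: "deg G x = card {y. (x, y) \<in> parcs G}"
proof -
  have "out_arcs (with_proj G) x = Pair x ` {y. (x, y) \<in> parcs G}"
    by (auto simp: out_arcs_def)
  then show ?thesis
    by (simp add: out_degree_def card_image inj_on_def)
qed

lemma verts_nonempty: "pverts G \<noteq> {}"
  using connected by (auto simp: Digraph_Component.connected_def strongly_connected_def mk_symmetric_def)

text \<open>Connectedness is defined through the symmetric closure, which preserves reachability
  here because the arcs are already symmetric.\<close>

lemma reachable_verts:
  assumes "u \<in> pverts G" and "v \<in> pverts G"
  shows "u \<rightarrow>\<^sup>*\<^bsub>with_proj G\<^esub> v"
proof -
  have "u \<rightarrow>\<^sup>*\<^bsub>with_proj (mk_symmetric (with_proj G))\<^esub> v"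
    using connected assms
    by (auto simp: Digraph_Component.connected_def strongly_connected_def mk_symmetric_def)
  then show ?thesis
    using reachable_mk_symmetric_eq[OF pair_sym_arcs] by simp
qed

text \<open>Maximum principle: a maximum at a harmonic vertex propagates to its neighbours.\<close>

lemma harmonic_le:
  fixes h :: "'a \<Rightarrow> real"
  assumes v: "v \<in> pverts G" and harm: "\<And>x. x \<in> pverts G \<Longrightarrow> x \<noteq> v \<Longrightarrow> lap G h x = 0"
    and x: "x \<in> pverts G"
  shows "h x \<le> h v"
proof -
  define m where "m = Max (h ` pverts G)"
  have le: "h y \<le> m" if "y \<in> pverts G" for y
    unfolding m_def using that pair_finite_verts by (intro Max_ge) auto
  have "m \<in> h ` pverts G"
    unfolding m_def using verts_nonempty pair_finite_verts by (intro Max_in) auto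
  then obtain u where u: "u \<in> pverts G" "h u = m"
    by auto
  have "h v = m"
  proof (rule ccontr)
    assume "h v \<noteq> m"
    \<comment> \<open>Induction along a path from the maximum \<open>u\<close>: every vertex with
      value \<open>m\<close> differs from \<open>v\<close>, hence is harmonic, and its neighbours
      again have value \<open>m\<close>.\<close>
    have "h w = m" if "(u, w) \<in> rtrancl_on (pverts G) (parcs G)" for w
      using that
    proof (induction rule: rtrancl_on_induct)
      case base
      then show ?case using u by simp
    next
      case (step y z)
      then have y: "y \<in> pverts G" "h y = m" and yz: "(y, z) \<in> parcs G"
        using arc_verts by auto
      have "lap G h y = 0"
        using harm[OF y(1)] y(2) \<open>h v \<noteq> m\<close> by auto
      then have "(\<Sum>z | (y, z) \<in> parcs G. m - h z) = 0"
        by (simp add: lap_def y(2))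
      then have "m - h z = 0"
        using yz arc_verts le finite_neighbours[of y] by (subst (asm) sum_nonneg_eq_0_iff) auto
      then show ?case by simp
    qed
    moreover have "(u, v) \<in> rtrancl_on (pverts G) (parcs G)"
      using reachable_verts[OF u(1) v] by (simp add: reachable_def)
    ultimately show False
      using \<open>h v \<noteq> m\<close> by blast
  qed
  then show ?thesis
    using le[OF x] by simp
qed

text \<open>The maximum principle for \<open>h\<close> and for \<open>- h\<close>.\<close>

lemma harmonic_eq_real:
  fixes h :: "'a \<Rightarrow> real"
  assumes "v \<in> pverts G" and "\<And>x. x \<in> pverts G \<Longrightarrow> x \<noteq> v \<Longrightarrow> lap G h x = 0"
    and "x \<in> pverts G"
  shows "h x = h v"
  using harmonic_le[of v h x] harmonic_le[of v "\<lambda>x. - h x" x] assms by (simp add: lap_uminus)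

lemma harmonic_eq:
  fixes h :: "'a \<Rightarrow> complex"
  assumes "v \<in> pverts G" and "\<And>x. x \<in> pverts G \<Longrightarrow> x \<noteq> v \<Longrightarrow> lap G h x = 0"
    and "x \<in> pverts G"
  shows "h x = h v"
  using harmonic_eq_real[of v "\<lambda>x. Re (h x)" x] harmonic_eq_real[of v "\<lambda>x. Im (h x)" x] assms
  by (simp add: complex_eq_iff flip: Re_lap Im_lap)

text \<open>The indicator function of an isolated vertex would be harmonic everywhere without being
  constant.\<close>

lemma deg_pos:
  assumes x: "x \<in> pverts G" and card: "card (pverts G) \<noteq> 1"
  shows "deg G x > 0"
proof (rule ccontr)
  assume "\<not> deg G x > 0"
  then have isolated: "(x, z) \<notin> parcs G" for z
    using finite_neighbours[of x] by (auto simp: deg_eq_card)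
  obtain y where y: "y \<in> pverts G" "y \<noteq> x"
  proof -
    have "pverts G \<noteq> {x}"
      using card by auto
    then show thesis
      using x that by blast
  qed
  define h :: "'a \<Rightarrow> real" where "h z = of_bool (z = x)" for z
  have "lap G h u = 0" for u
    unfolding lap_def using isolated arc_sym by (intro sum.neutral) (auto simp: h_def)
  then have "h y = h x"
    using x y by (intro harmonic_eq_real) auto
  then show False
    using y by (simp add: h_def)
qed

lemma sum_deg: "(\<Sum>x\<in>pverts G. deg G x) = 2 * card (edge_set G)"
proof -
  have "(\<Sum>x\<in>pverts G. deg G x) = (\<Sum>x\<in>pverts G. \<Sum>y | (x, y) \<in> parcs G. 1)"
    by (simp add: deg_eq_card)
  also have "\<dots> = (\<Sum>(x, y)\<in>Sigma (pverts G) (\<lambda>x. {y. (x, y) \<in> parcs G}). 1)"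
    by (rule sum.Sigma) (auto simp: pair_finite_verts finite_neighbours)
  also have "Sigma (pverts G) (\<lambda>x. {y. (x, y) \<in> parcs G}) = parcs G"
    using arc_verts by auto
  also have "(\<Sum>(x, y)\<in>parcs G. 1) = 2 * (\<Sum>e\<in>edge_set G. 1 :: nat)"
    unfolding edge_set_def using no_loop arc_sym
    by (intro sum_symmetric_pairs) (auto simp: pair_finite_arcs irrefl_def sym_def)
  finally show ?thesis
    by simp
qed

lemma lap_entry_sym: "lap_entry G x y = lap_entry G y x"
  by (simp add: lap_entry_def arc_sym)

lemma sum_lap_entry:
  assumes x: "x \<in> pverts G"
  shows "(\<Sum>y\<in>pverts G. lap_entry G x y * h y) = lap G h x"
proof -
  have "(\<Sum>y\<in>pverts G. of_bool ((x, y) \<in> parcs G) * h y) = (\<Sum>y | (x, y) \<in> parcs G. h y)"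
    using pair_finite_verts arc_verts by (intro sum.mono_neutral_cong_right) auto
  then show ?thesis
    using x pair_finite_verts
    by (simp add: lap_entry_def lap_def deg_eq_card left_diff_distrib sum_subtractf
        if_distrib[of "\<lambda>c. c * _"] cong: if_cong)
qed

text \<open>By symmetry of \<open>lap_entry\<close>, its column sums equal its row sums, which
  vanish. Electrically, the net currents at all vertices add up to 0.\<close>

lemma sum_lap:
  fixes h :: "'a \<Rightarrow> complex"
  shows "(\<Sum>x\<in>pverts G. lap G h x) = 0"
proof -
  have "(\<Sum>x\<in>pverts G. lap G h x) = (\<Sum>y\<in>pverts G. \<Sum>x\<in>pverts G. lap_entry G x y * h y)"
    by (subst sum.swap) (simp add: sum_lap_entry)
  also have "\<dots> = (\<Sum>y\<in>pverts G. \<Sum>x\<in>pverts G. lap_entry G y x * h y)"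
    by (intro sum.cong refl arg_cong2[of _ _ _ _ "(*)"] lap_entry_sym)
  also have "\<dots> = (\<Sum>y\<in>pverts G. lap G (\<lambda>_. 1) y * h y)"
    using sum_lap_entry[of _ "\<lambda>_. 1"] by (simp flip: sum_distrib_right)
  finally show ?thesis
    by (simp add: lap_const)
qed

text \<open>Two potentials of the same current differ by a harmonic function, hence by a constant,
  so any one of them determines the resistance.\<close>

lemma eff_resistance_eqI:
  assumes vw: "v \<in> pverts G" "w \<in> pverts G" and h: "unit_current_potential G v w h"
  shows "eff_resistance G v w = h v - h w"
  unfolding eff_resistance_def
proof (rule the_equality)
  fix r assume "\<exists>h. unit_current_potential G v w h \<and> r = h v - h w"
  then obtain h' where h': "unit_current_potential G v w h'" and r: "r = h' v - h' w"
    by auto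
  have "h v - h' v = h w - h' w"
    using harmonic_eq_real[of w "\<lambda>x. h x - h' x" v] vw h h'
    by (simp add: unit_current_potential_altdef lap_diff)
  then show "r = h v - h w"
    using r by simp
qed (use h in auto)

lemma eff_resistance_self: "v \<in> pverts G \<Longrightarrow> eff_resistance G v v = 0"
  using eff_resistance_eqI[of v v "\<lambda>_. 0"] by (simp add: unit_current_potential_altdef lap_const)

end

section \<open>Row-scaled Laplace matrices\<close>

text \<open>\<open>insert_index k\<close> translates positions after deletion of \<open>k\<close>
  into the original positions other than \<open>k\<close>.\<close>

lemma sum_insert_index:
  fixes F :: "nat \<Rightarrow> 'b :: comm_monoid_add"
  assumes "k < n"
  shows "(\<Sum>j<n - 1. F (insert_index k j)) = (\<Sum>j\<in>{..<n} - {k}. F j)"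
proof -
  have "insert_index k ` {..<n - 1} = {..<n} - {k}"
    using insert_index_image[of k "n - 1"] assms by (simp add: atLeast0LessThan)
  then show ?thesis
    using sum.reindex[OF insert_index_inj_on[of k "{..<n - 1}"], of F] by (simp add: comp_def)
qed

locale enumerated_graph = connected_pair_graph G for G :: "'a pair_pre_digraph" +
  fixes vs :: "'a list"
  assumes vs: "distinct vs" "set vs = pverts G"
begin

abbreviation "n \<equiv> length vs"

lemma nth_verts: "i < n \<Longrightarrow> vs ! i \<in> pverts G"
  using vs(2) by auto

lemma n_pos: "n > 0"
  using verts_nonempty vs(2) by auto

lemma n_eq_card: "n = card (pverts G)"
  using distinct_card[OF vs(1)] vs(2) by simp

lemma vertE:
  assumes "x \<in> pverts G"
  obtains i where "i < n" "x = vs ! i"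
  using assms vs(2) by (metis in_set_conv_nth)

lemma sum_nth: "(\<Sum>i<n. f (vs ! i)) = (\<Sum>x\<in>pverts G. f x)"
  using sum.reindex_bij_betw[OF bij_betw_nth[OF vs(1) refl vs(2)[symmetric]], of f] by simp

lemma insert_index_less: "k < n \<Longrightarrow> i < n - 1 \<Longrightarrow> insert_index k i < n"
  by (auto simp: insert_index_def)

lemma ex_index_function: "\<exists>h. \<forall>i<n. h (vs ! i) = F i"
proof (intro exI allI impI)
  fix i assume "i < n"
  then show "(\<lambda>x. F (inv_into {..<n} ((!) vs) x)) (vs ! i) = F i"
    using vs(1) by (simp add: inv_into_f_f inj_on_nth)
qed

text \<open>The kernel of the Laplace matrix consists of the constant vectors, here in terms of
  positions so that it applies to rows and columns of an adjugate.\<close>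

lemma harmonic_index_eq:
  assumes F: "\<And>i. i < n \<Longrightarrow> (\<Sum>l<n. lap_entry G (vs ! i) (vs ! l) * F l) = 0"
    and ij: "i < n" "j < n"
  shows "F i = F j"
proof -
  obtain h where h: "\<And>i. i < n \<Longrightarrow> h (vs ! i) = F i"
    using ex_index_function[of F] by blast
  have "lap G h x = 0" if x: "x \<in> pverts G" for x
  proof -
    obtain i where i: "i < n" "x = vs ! i"
      using x by (rule vertE)
    show ?thesis
      using F[OF i(1)] h sum_nth[of "\<lambda>y. lap_entry G x y * h y"] sum_lap_entry[OF x, of h]
      by (simp add: i(2))
  qed
  then show ?thesis
    using harmonic_eq[of "vs ! j" h "vs ! i"] ij h by (simp add: nth_verts)
qed

end

text \<open>
  Scaling the rows of the Laplace matrix by \<open>1 / a\<close> covers both matrices of the theorem: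
  \<open>a = 1\<close> gives \<open>L\<close> and \<open>a = deg\<close> gives \<open>N\<close>, the latter except for the one-vertex graph,
  where the degree vanishes but \<open>N = 1\<close>.
\<close>

locale weighted_enumerated_graph = enumerated_graph +
  fixes a :: "'a \<Rightarrow> complex"
  assumes a_nz: "x \<in> pverts G \<Longrightarrow> a x \<noteq> 0"
begin

definition wlap :: "complex mat" where
  "wlap = mat n n (\<lambda>(i, j). lap_entry G (vs ! i) (vs ! j) / a (vs ! i))"

lemma wlap_carrier: "wlap \<in> carrier_mat n n"
  by (simp add: wlap_def)

lemma dim_wlap [simp]: "dim_row wlap = n" "dim_col wlap = n"
  by (simp_all add: wlap_def)

text \<open>Deleting row and column \<open>k\<close> corresponds to fixing the potential of
  \<open>vs ! k\<close> at 0.\<close>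

abbreviation grounded :: "nat \<Rightarrow> complex mat" where
  "grounded k \<equiv> mat_delete wlap k k"

lemma grounded_carrier: "grounded k \<in> carrier_mat (n - 1) (n - 1)"
  using wlap_carrier by (rule mat_delete_carrier)

text \<open>The constant vector lies in the kernel: the rows of the Laplace matrix sum to 0, and
  scaling rows preserves this.\<close>

lemma det_wlap: "det wlap = 0"
proof -
  have "wlap *\<^sub>v vec n (\<lambda>_. 1) = 0\<^sub>v n"
  proof (rule eq_vecI)
    fix i assume "i < dim_vec (0\<^sub>v n :: complex vec)"
    then have i: "i < n" by simp
    have "(wlap *\<^sub>v vec n (\<lambda>_. 1)) $ i = (\<Sum>j<n. lap_entry G (vs ! i) (vs ! j) * 1) / a (vs ! i)"
      using i by (simp add: wlap_def scalar_prod_def atLeast0LessThan sum_divide_distrib)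
    also have "\<dots> = 0"
      using sum_nth[of "\<lambda>y. lap_entry G (vs ! i) y * 1"] sum_lap_entry[OF nth_verts[OF i], of "\<lambda>_. 1"]
      by (simp add: lap_const)
    finally show "(wlap *\<^sub>v vec n (\<lambda>_. 1)) $ i = 0\<^sub>v n $ i"
      using i by simp
  qed (simp add: wlap_def)
  moreover have "vec n (\<lambda>_. 1 :: complex) \<noteq> 0\<^sub>v n"
    using n_pos by (auto simp: vec_eq_iff)
  ultimately show ?thesis
    using det_0_iff_vec_prod_zero[OF wlap_carrier] vec_carrier by blast
qed

text \<open>
  The adjugate is annihilated by the singular matrix from both sides. The right kernel is spanned
  by the constant vector and the left kernel by the weights, so its entries are \<open>c * a j\<close>.
\<close>

lemma det_grounded_proportional: "\<exists>c. \<forall>k<n. det (grounded k) = c * a (vs ! k)"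
proof -
  let ?C = "adj_mat wlap"
  have C: "?C \<in> carrier_mat n n"
    using adj_mat(1)[OF wlap_carrier] .
  have col: "?C $$ (i, j) = ?C $$ (i', j)" if "i < n" "i' < n" and j: "j < n" for i i' j
  proof (rule harmonic_index_eq[OF _ that(1,2)])
    fix l assume l: "l < n"
    have "0 = (wlap * ?C) $$ (l, j)"
      using l j by (simp add: adj_mat(2)[OF wlap_carrier] det_wlap)
    also have "\<dots> = (\<Sum>i<n. lap_entry G (vs ! l) (vs ! i) * ?C $$ (i, j)) / a (vs ! l)"
      using l j C by (simp add: wlap_def scalar_prod_def atLeast0LessThan sum_divide_distrib)
    finally show "(\<Sum>i<n. lap_entry G (vs ! l) (vs ! i) * ?C $$ (i, j)) = 0"
      using a_nz[OF nth_verts[OF l]] by simp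
  qed
  have row: "?C $$ (i, j) / a (vs ! j) = ?C $$ (i, j') / a (vs ! j')"
    if "j < n" "j' < n" and i: "i < n" for i j j'
  proof (rule harmonic_index_eq[OF _ that(1,2)])
    fix l assume l: "l < n"
    have "0 = (?C * wlap) $$ (i, l)"
      using l i by (simp add: adj_mat(3)[OF wlap_carrier] det_wlap)
    also have "\<dots> = (\<Sum>j<n. ?C $$ (i, j) * (lap_entry G (vs ! j) (vs ! l) / a (vs ! j)))"
      using l i C by (simp add: wlap_def scalar_prod_def atLeast0LessThan)
    also have "\<dots> = (\<Sum>j<n. lap_entry G (vs ! l) (vs ! j) * (?C $$ (i, j) / a (vs ! j)))"
      by (intro sum.cong refl) (simp add: lap_entry_sym[of _ "vs ! l"])
    finally show "(\<Sum>j<n. lap_entry G (vs ! l) (vs ! j) * (?C $$ (i, j) / a (vs ! j))) = 0"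
      by simp
  qed
  show ?thesis
  proof (intro exI allI impI)
    fix k assume k: "k < n"
    have "det (grounded k) = ?C $$ (k, k)"
      using k wlap_carrier by (simp add: adj_mat_def cofactor_def flip: mult_2)
    \<comment> \<open>The constant comes from the corner entry: \<open>row\<close> moves
      \<open>(k, k)\<close> to \<open>(k, 0)\<close> at the cost of a ratio of weights, and
      \<open>col\<close> moves \<open>(k, 0)\<close> to \<open>(0, 0)\<close>.\<close>
    then show "det (grounded k) = ?C $$ (0, 0) / a (vs ! 0) * a (vs ! k)"
      using row[OF k n_pos k] col[OF k n_pos n_pos] a_nz[OF nth_verts[OF k]] by (simp add: field_simps)
  qed
qed

section \<open>Potentials with one vertex grounded\<close>

text \<open>As \<open>h\<close> vanishes at the deleted vertex, the dropped column contributes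
  nothing, so the reduced matrix still acts as the scaled Laplacian at the other vertices.\<close>

lemma grounded_mult_vec:
  assumes k: "k < n" and i: "i < n - 1" and h: "h (vs ! k) = 0"
  shows "(grounded k *\<^sub>v vec (n - 1) (\<lambda>j. h (vs ! insert_index k j))) $ i
    = lap G h (vs ! insert_index k i) / a (vs ! insert_index k i)"
proof -
  define x where "x = vs ! insert_index k i"
  have x: "x \<in> pverts G"
    using insert_index_less[OF k i] by (simp add: x_def nth_verts)
  have entry: "grounded k $$ (i, j) = lap_entry G x (vs ! insert_index k j) / a x" if "j < n - 1" for j
    using that k i insert_index_less[OF k]
    by (simp add: mat_delete_def wlap_def x_def flip: insert_index_def)
  have "(grounded k *\<^sub>v vec (n - 1) (\<lambda>j. h (vs ! insert_index k j))) $ i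
      = (\<Sum>j<n - 1. lap_entry G x (vs ! insert_index k j) * h (vs ! insert_index k j)) / a x"
    using i entry by (simp add: scalar_prod_def atLeast0LessThan sum_divide_distrib)
  also have "(\<Sum>j<n - 1. lap_entry G x (vs ! insert_index k j) * h (vs ! insert_index k j))
      = (\<Sum>j\<in>{..<n} - {k}. lap_entry G x (vs ! j) * h (vs ! j))"
    by (rule sum_insert_index[OF k])
  also have "\<dots> = (\<Sum>j<n. lap_entry G x (vs ! j) * h (vs ! j))"
    using h by (intro sum.mono_neutral_left) auto
  also have "\<dots> = lap G h x"
    by (simp add: sum_nth[of "\<lambda>y. lap_entry G x y * h y"] sum_lap_entry[OF x])
  finally show ?thesis
    by (simp add: x_def)
qed

lemma vec_extendE:
  fixes x :: "complex vec"
  assumes k: "k < n" and x: "x \<in> carrier_vec (n - 1)"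
  obtains h where "h (vs ! k) = 0" "x = vec (n - 1) (\<lambda>j. h (vs ! insert_index k j))"
proof -
  obtain h where h: "\<And>i. i < n \<Longrightarrow> h (vs ! i) = (if i = k then 0 else x $ delete_index k i)"
    using ex_index_function[of "\<lambda>i. if i = k then 0 else x $ delete_index k i"] by blast
  have "x = vec (n - 1) (\<lambda>j. h (vs ! insert_index k j))"
    using x insert_index_less[OF k] by (intro eq_vecI) (auto simp: h)
  then show thesis
    using that[of h] h[OF k] by simp
qed

lemma other_vertE:
  assumes "k < n" and "x \<in> pverts G" and "x \<noteq> vs ! k"
  obtains i where "i < n - 1" "x = vs ! insert_index k i"
proof -
  obtain j where j: "j < n" "x = vs ! j"
    using assms(2) by (rule vertE)
  then have "j \<in> insert_index k ` {0..<n - 1}"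
    using insert_index_image[of k "n - 1"] assms by auto
  then show thesis
    using that j by auto
qed

text \<open>A kernel vector, extended by 0 at the grounded vertex, is harmonic elsewhere and
  therefore constantly 0.\<close>

lemma det_grounded_nz:
  assumes k: "k < n"
  shows "det (grounded k) \<noteq> 0"
proof
  assume "det (grounded k) = 0"
  then obtain x where x: "x \<in> carrier_vec (n - 1)" "x \<noteq> 0\<^sub>v (n - 1)" "grounded k *\<^sub>v x = 0\<^sub>v (n - 1)"
    using det_0_iff_vec_prod_zero[OF grounded_carrier] by blast
  obtain h where h: "h (vs ! k) = 0" "x = vec (n - 1) (\<lambda>j. h (vs ! insert_index k j))"
    using k x(1) by (rule vec_extendE)
  have "lap G h u = 0" if u: "u \<in> pverts G" "u \<noteq> vs ! k" for u
  proof -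
    obtain i where i: "i < n - 1" "u = vs ! insert_index k i"
      using k u by (rule other_vertE)
    show ?thesis
      using grounded_mult_vec[of k i h, OF k i(1) h(1), folded h(2) i(2), unfolded x(3)] a_nz[OF u(1)] i(1)
      by simp
  qed
  then have "h u = 0" if "u \<in> pverts G" for u
    using harmonic_eq[OF nth_verts[OF k], of h u] that h(1) by simp
  then have "x = 0\<^sub>v (n - 1)"
    using insert_index_less[OF k] by (auto simp: h(2) nth_verts vec_eq_iff)
  then show False
    using x(2) by simp
qed

text \<open>
  The potential of a unit current into \<open>w\<close> with \<open>v\<close> grounded solves the linear system of the
  matrix with row and column \<open>v\<close> deleted, so Cramer's rule expresses its value at \<open>w\<close> by a minor.
\<close>

lemma minor_potentialE:
  assumes k: "k < n" and i: "i < n - 1"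
  defines "v \<equiv> vs ! k" and "w \<equiv> vs ! insert_index k i"
  obtains h :: "'a \<Rightarrow> real" where "h v = 0" "unit_current_potential G w v h"
    "det (mat_delete (grounded k) i i) = a w * of_real (h w) * det (grounded k)"
proof -
  have w: "w \<in> pverts G" and v: "v \<in> pverts G"
    using insert_index_less[OF k i] k by (simp_all add: w_def v_def nth_verts)
  have "w \<noteq> v"
    using vs(1) k insert_index_less[OF k i] by (simp add: w_def v_def nth_eq_iff_index_eq)
  let ?d = "det (grounded k)" and ?C = "adj_mat (grounded k)"
  note C = adj_mat[OF grounded_carrier[of k]]
  \<comment> \<open>Multiplying by the adjugate and then by the matrix yields the factor
    \<open>?d\<close>. Hence \<open>x\<close> solves the system with right-hand side
    \<open>1 / a w\<close> at \<open>w\<close>, which is a unit current into \<open>w\<close> after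
    the row scaling.\<close>
  define b where "b = (1 / (a w * ?d)) \<cdot>\<^sub>v unit_vec (n - 1) i"
  have b: "b \<in> carrier_vec (n - 1)"
    by (simp add: b_def)
  define x where "x = ?C *\<^sub>v b"
  have x: "x \<in> carrier_vec (n - 1)"
    using C(1) b by (simp add: x_def)
  have "grounded k *\<^sub>v x = (grounded k * ?C) *\<^sub>v b"
    unfolding x_def using assoc_mult_mat_vec[OF grounded_carrier C(1) b] by simp
  also have "\<dots> = ?d \<cdot>\<^sub>v b"
    using b by (intro eq_vecI) (auto simp: C(2))
  finally have Bx: "grounded k *\<^sub>v x = ?d \<cdot>\<^sub>v b" .
  obtain h where h: "h v = 0" "x = vec (n - 1) (\<lambda>j. h (vs ! insert_index k j))"
    using vec_extendE[OF k x] unfolding v_def by blast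
  have lap_off: "lap G h u = of_bool (u = w)" if u: "u \<in> pverts G" "u \<noteq> v" for u
  proof -
    obtain j where j: "j < n - 1" "u = vs ! insert_index k j"
      using k u other_vertE unfolding v_def by blast
    have "u = w \<longleftrightarrow> j = i"
      using vs(1) i j insert_index_less[OF k] inj_onD[OF insert_index_inj_on[of k UNIV], of j i]
      by (auto simp: w_def nth_eq_iff_index_eq)
    moreover have "lap G h u / a u = (?d \<cdot>\<^sub>v b) $ j"
      using grounded_mult_vec[of k j h, OF k j(1)] h Bx by (simp add: j(2) v_def)
    ultimately show ?thesis
      using a_nz[OF u(1)] det_grounded_nz[OF k] i j(1) by (auto simp: b_def)
  qed
  \<comment> \<open>The row of \<open>v\<close> was deleted from the system, but since all net
    currents sum to 0, the one at \<open>v\<close> must be -1.\<close>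
  have "lap G h v = - (\<Sum>u\<in>pverts G - {v}. lap G h u)"
    using sum_lap[of h] sum.remove[OF pair_finite_verts v, of "lap G h"]
    by (simp add: eq_neg_iff_add_eq_0)
  also have "(\<Sum>u\<in>pverts G - {v}. lap G h u) = (\<Sum>u\<in>pverts G - {v}. if w = u then 1 else 0)"
    by (rule sum.cong) (auto simp: lap_off)
  also have "\<dots> = 1"
    using w \<open>w \<noteq> v\<close> pair_finite_verts by simp
  finally have lap_h: "lap G h u = of_bool (u = w) - of_bool (u = v)" if "u \<in> pverts G" for u
    using lap_off that \<open>w \<noteq> v\<close> by (cases "u = v") auto
  \<comment> \<open>All net currents of \<open>h\<close> are real, so its imaginary part is
    harmonic, and it is 0 at \<open>v\<close>.\<close>
  have Im_h: "Im (h w) = 0"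
    using harmonic_eq_real[OF v _ w, of "\<lambda>u. Im (h u)"] lap_h h(1) by (simp flip: Im_lap)
  have "h w = x $ i"
    using i by (simp add: h(2) w_def)
  also have "\<dots> = ?C $$ (i, i) / (a w * ?d)"
    using i C(1) by (simp add: x_def b_def)
  also have "?C $$ (i, i) = det (mat_delete (grounded k) i i)"
    using i grounded_carrier[of k] by (simp add: adj_mat_def cofactor_def flip: mult_2)
  finally have "det (mat_delete (grounded k) i i) = a w * of_real (Re (h w)) * ?d"
    using a_nz[OF w] det_grounded_nz[OF k] Im_h by (simp add: complex_is_Real_iff field_simps)
  moreover have "unit_current_potential G w v (\<lambda>u. Re (h u))"
    using lap_h by (simp add: unit_current_potential_altdef flip: Re_lap)
  ultimately show thesis
    using that[of "\<lambda>u. Re (h u)"] h(1) by simp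
qed

text \<open>Reversing the current negates the potential, so with \<open>v\<close> grounded both
  resistances equal the value at \<open>w\<close> of the potential given by Cramer's rule.\<close>

lemma minor_eff_resistance:
  assumes k: "k < n" and i: "i < n - 1"
  defines "v \<equiv> vs ! k" and "w \<equiv> vs ! insert_index k i"
  shows "eff_resistance G v w = eff_resistance G w v"
    and "det (mat_delete (grounded k) i i) = a w * of_real (eff_resistance G v w) * det (grounded k)"
proof -
  have w: "w \<in> pverts G" and v: "v \<in> pverts G"
    using insert_index_less[OF k i] k by (simp_all add: w_def v_def nth_verts)
  obtain h where h: "h v = 0" "unit_current_potential G w v h"
    "det (mat_delete (grounded k) i i) = a w * of_real (h w) * det (grounded k)"
    using minor_potentialE[OF k i] unfolding v_def w_def by blast
  have "unit_current_potential G v w (\<lambda>u. - h u)"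
    using h(2) by (simp add: unit_current_potential_altdef lap_uminus)
  then have vw: "eff_resistance G v w = h w"
    using eff_resistance_eqI[OF v w] h(1) by simp
  then show "eff_resistance G v w = eff_resistance G w v"
    using eff_resistance_eqI[OF w v h(2)] h(1) by simp
  show "det (mat_delete (grounded k) i i) = a w * of_real (eff_resistance G v w) * det (grounded k)"
    using h(3) vw by simp
qed

lemma eff_resistance_sym:
  assumes v: "v \<in> pverts G" and w: "w \<in> pverts G"
  shows "eff_resistance G v w = eff_resistance G w v"
proof (cases "v = w")
  case False
  obtain k where k: "k < n" "v = vs ! k"
    using v by (rule vertE)
  obtain i where i: "i < n - 1" "w = vs ! insert_index k i"
    using k(1) w False k(2) other_vertE by metis
  show ?thesis
    using minor_eff_resistance(1)[OF k(1) i(1)] by (simp add: k(2) i(2))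
qed simp

section \<open>Resistance sums as sums over eigenvalues\<close>

lemma not_eigenvalue_grounded_0: "k < n \<Longrightarrow> \<not> eigenvalue (grounded k) 0"
  using det_grounded_nz by (simp add: eigenvalue_root_char_poly[OF grounded_carrier] poly_char_poly_0[OF grounded_carrier])

text \<open>Each quotient of a minor by the determinant is \<open>a w\<close> times a resistance
  from the grounded vertex. The grounded vertex itself can be added to the sum because its
  resistance to itself is 0.\<close>

lemma sum_reciprocal_eigenvalues_grounded:
  assumes k: "k < n"
  shows "(\<Sum>\<mu> | eigenvalue (grounded k) \<mu>. of_nat (alg_mult (grounded k) \<mu>) * (1 / \<mu>))
    = (\<Sum>w\<in>pverts G. a w * of_real (eff_resistance G (vs ! k) w))"
proof -
  let ?f = "\<lambda>w. a w * of_real (eff_resistance G (vs ! k) w)"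
  have "(\<Sum>\<mu> | eigenvalue (grounded k) \<mu>. of_nat (alg_mult (grounded k) \<mu>) * (1 / \<mu>))
      = (\<Sum>i<n - 1. det (mat_delete (grounded k) i i)) / det (grounded k)"
    by (rule sum_reciprocal_eigenvalues[OF grounded_carrier det_grounded_nz[OF k]])
  also have "\<dots> = (\<Sum>i<n - 1. ?f (vs ! insert_index k i))"
    using det_grounded_nz[OF k] by (simp add: minor_eff_resistance(2)[OF k] flip: sum_distrib_right)
  also have "\<dots> = (\<Sum>j\<in>{..<n} - {k}. ?f (vs ! j))"
    by (rule sum_insert_index[OF k])
  also have "\<dots> = (\<Sum>j<n. ?f (vs ! j))"
    using eff_resistance_self[OF nth_verts[OF k]] by (intro sum.mono_neutral_left) auto
  finally show ?thesis
    by (simp add: sum_nth[of ?f])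
qed

text \<open>The principal minors are \<open>c * a x\<close>, so the quotient of derivatives is half
  the average of the vertex sums with weights \<open>a x\<close>, and \<open>c\<close>
  cancels.\<close>

lemma sum_reciprocal_nonzero_eigenvalues_wlap:
  assumes "(\<Sum>x\<in>pverts G. a x) \<noteq> 0"
  shows "1 / 2 * (\<Sum>x\<in>pverts G. \<Sum>y\<in>pverts G. a x * a y * of_real (eff_resistance G x y))
    = (\<Sum>x\<in>pverts G. a x) * (\<Sum>\<mu> | eigenvalue wlap \<mu> \<and> \<mu> \<noteq> 0. of_nat (alg_mult wlap \<mu>) * (1 / \<mu>))"
proof -
  let ?S = "\<Sum>x\<in>pverts G. a x"
  let ?R = "\<lambda>x. \<Sum>y\<in>pverts G. a y * of_real (eff_resistance G x y)"
  obtain c where c: "\<And>k. k < n \<Longrightarrow> det (grounded k) = c * a (vs ! k)"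
    using det_grounded_proportional by blast
  have "c \<noteq> 0"
    using c[OF n_pos] det_grounded_nz[OF n_pos] by auto
  have minors: "(\<Sum>k<n. det (grounded k)) = c * ?S"
    by (simp add: c sum_nth[of a] flip: sum_distrib_left)
  have "(\<Sum>k<n. det (grounded k) * (\<Sum>\<mu> | eigenvalue (grounded k) \<mu>. of_nat (alg_mult (grounded k) \<mu>) * (1 / \<mu>)))
      = (\<Sum>k<n. c * (a (vs ! k) * ?R (vs ! k)))"
    by (intro sum.cong refl) (simp only: c sum_reciprocal_eigenvalues_grounded lessThan_iff mult.assoc)
  also have "\<dots> = c * (\<Sum>x\<in>pverts G. a x * ?R x)"
    by (simp only: sum_distrib_left[symmetric] sum_nth[of "\<lambda>x. a x * ?R x"])
  finally have "(\<Sum>\<mu> | eigenvalue wlap \<mu> \<and> \<mu> \<noteq> 0. of_nat (alg_mult wlap \<mu>) * (1 / \<mu>))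
      = c * (\<Sum>x\<in>pverts G. a x * ?R x) / (2 * (c * ?S))"
    using sum_reciprocal_nonzero_eigenvalues[OF wlap_carrier det_wlap det_grounded_nz] minors assms \<open>c \<noteq> 0\<close>
    by simp
  moreover have "(\<Sum>x\<in>pverts G. \<Sum>y\<in>pverts G. a x * a y * of_real (eff_resistance G x y))
      = (\<Sum>x\<in>pverts G. a x * ?R x)"
    by (simp add: sum_distrib_left mult.assoc)
  ultimately show ?thesis
    using assms \<open>c \<noteq> 0\<close> by simp
qed

text \<open>Symmetry of the resistance makes the description over unordered pairs unique; ordered
  pairs count each value twice, and the diagonal adds 0.\<close>

lemma kirchhoff_index_eq:
  "kirchhoff_index G = 1 / 2 * (\<Sum>x\<in>pverts G. \<Sum>y\<in>pverts G. eff_resistance G x y)"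
proof -
  let ?R = "{(x, y) \<in> pverts G \<times> pverts G. x \<noteq> y}"
  let ?g = "\<lambda>e. THE r. \<exists>x y. e = {x, y} \<and> r = eff_resistance G x y"
  have g: "?g {x, y} = eff_resistance G x y" if "(x, y) \<in> ?R" for x y
    using that eff_resistance_sym by (intro the_equality) (auto simp: doubleton_eq_iff)
  have "{{x, y} |x y. (x, y) \<in> ?R} = {e. e \<subseteq> pverts G \<and> card e = 2}"
    by (auto simp: card_2_iff)
  then have "2 * kirchhoff_index G = 2 * (\<Sum>e\<in>{{x, y} |x y. (x, y) \<in> ?R}. ?g e)"
    by (simp add: kirchhoff_index_def)
  also have "\<dots> = (\<Sum>(x, y)\<in>?R. eff_resistance G x y)"
    using pair_finite_verts
    by (intro sum_symmetric_pairs[symmetric] g) (auto simp: irrefl_def sym_def intro: finite_subset)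
  also have "\<dots> = (\<Sum>(x, y)\<in>pverts G \<times> pverts G. eff_resistance G x y)"
    using pair_finite_verts eff_resistance_self by (intro sum.mono_neutral_left) auto
  also have "\<dots> = (\<Sum>x\<in>pverts G. \<Sum>y\<in>pverts G. eff_resistance G x y)"
    by (rule sum.cartesian_product[symmetric])
  finally show ?thesis
    by simp
qed

end

section \<open>Specialization of the weights to \<open>L\<close> and \<open>N\<close>\<close>

theorem theorem7:
  fixes G :: "'a pair_pre_digraph" and vs :: "'a list" and L M N :: "complex mat" and n m :: nat
  assumes "pair_graph G" and "Digraph_Component.connected (with_proj G)"
    and "n = card (pverts G)" and "m = card (edge_set G)"
    and "distinct vs" and "set vs = pverts G"
    and "L = laplace_mat G vs" and "M = transition_mat G vs" and "N = 1\<^sub>m n - M"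
  shows
    "complex_of_real (kirchhoff_index G) =
       of_nat n * (\<Sum>\<mu> | eigenvalue L \<mu> \<and> \<mu> \<noteq> 0. of_nat (alg_mult L \<mu>) * (1 / \<mu>))
     \<and> complex_of_real (mult_degree_kirchhoff_index G) =
       2 * of_nat m * (\<Sum>\<mu> | eigenvalue N \<mu> \<and> \<mu> \<noteq> 0. of_nat (alg_mult N \<mu>) * (1 / \<mu>))
     \<and> (\<forall>k<n. \<forall>v L\<^sub>v N\<^sub>v. v = vs ! k \<longrightarrow> L\<^sub>v = mat_delete L k k \<longrightarrow> N\<^sub>v = mat_delete N k k \<longrightarrow>
          \<not> eigenvalue L\<^sub>v 0
        \<and> complex_of_real (vertex_resistance G v) =
            (\<Sum>\<mu> | eigenvalue L\<^sub>v \<mu>. of_nat (alg_mult L\<^sub>v \<mu>) * (1 / \<mu>))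
        \<and> \<not> eigenvalue N\<^sub>v 0
        \<and> complex_of_real (degree_vertex_resistance G v) =
            (\<Sum>\<mu> | eigenvalue N\<^sub>v \<mu>. of_nat (alg_mult N\<^sub>v \<mu>) * (1 / \<mu>)))"
proof -
  interpret pair_graph G
    by fact
  interpret unw: weighted_enumerated_graph G vs "\<lambda>_. 1"
    by unfold_locales (use assms in auto)
  have n: "n = length vs"
    using assms(3) unw.n_eq_card by simp
  have L: "L = unw.wlap"
    using assms(5) by (intro eq_matI)
      (auto simp: assms(7) unw.wlap_def laplace_mat_def degree_mat_def adjacency_mat_def lap_entry_def
        nth_eq_iff_index_eq)
  have part1: "complex_of_real (kirchhoff_index G) =
      of_nat n * (\<Sum>\<mu> | eigenvalue L \<mu> \<and> \<mu> \<noteq> 0. of_nat (alg_mult L \<mu>) * (1 / \<mu>))"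
    using unw.sum_reciprocal_nonzero_eigenvalues_wlap unw.verts_nonempty unw.n_pos unw.n_eq_card
    by (simp add: L n unw.kirchhoff_index_eq)
  have part3: "\<not> eigenvalue (mat_delete L k k) 0 \<and> complex_of_real (vertex_resistance G (vs ! k)) =
      (\<Sum>\<mu> | eigenvalue (mat_delete L k k) \<mu>. of_nat (alg_mult (mat_delete L k k) \<mu>) * (1 / \<mu>))"
    if "k < n" for k
    using that unw.not_eigenvalue_grounded_0[of k] unw.sum_reciprocal_eigenvalues_grounded[of k]
    by (simp add: L n vertex_resistance_def)
  have part24: "complex_of_real (mult_degree_kirchhoff_index G) =
      2 * of_nat m * (\<Sum>\<mu> | eigenvalue N \<mu> \<and> \<mu> \<noteq> 0. of_nat (alg_mult N \<mu>) * (1 / \<mu>))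
    \<and> (\<forall>k<n. \<not> eigenvalue (mat_delete N k k) 0
      \<and> complex_of_real (degree_vertex_resistance G (vs ! k)) =
        (\<Sum>\<mu> | eigenvalue (mat_delete N k k) \<mu>. of_nat (alg_mult (mat_delete N k k) \<mu>) * (1 / \<mu>)))"
  \<comment> \<open>With one vertex the degree is 0 and cannot serve as a weight. Both sides are
    then 0: there is no edge, and the reduced matrix is empty and has no eigenvalues.\<close>
  proof (cases "n = 1")
    case True
    obtain x where x: "pverts G = {x}"
      using True assms(3) by (metis card_1_singletonE)
    have "(x, y) \<notin> parcs G" for y
      using unw.arc_verts[of x y] unw.no_loop[of x] x by auto
    then have "deg G x = 0"
      by (simp add: unw.deg_eq_card)
    moreover have "m = 0"
      using unw.sum_deg x calculation assms(4) by simp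
    moreover have "N \<in> carrier_mat n n"
      by (intro carrier_matI) (simp_all add: assms(8,9) transition_mat_def n)
    then have "mat_delete N k k \<in> carrier_mat 0 0" for k
      using mat_delete_carrier[of N n n k k] True by simp
    then have "\<not> eigenvalue (mat_delete N k k) \<mu>" for k \<mu>
      using eigenvalue_imp_nonzero_dim by blast
    ultimately show ?thesis
      using x by (simp add: mult_degree_kirchhoff_index_def degree_vertex_resistance_def)
  next
    case False
    have deg: "deg G x > 0" if "x \<in> pverts G" for x
      using unw.deg_pos[OF that] False assms(3) by simp
    interpret wtd: weighted_enumerated_graph G vs "\<lambda>x. of_nat (deg G x)"
      by unfold_locales (use deg in force)
    have deg_nz: "deg G (vs ! i) \<noteq> 0" if "i < length vs" for i
      using deg[OF unw.nth_verts[OF that]] by simp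
    \<comment> \<open>The diagonal entry 1 of \<open>N\<close> arises as degree divided by degree,
      as there are no loops and the degrees are positive.\<close>
    have N: "N = wtd.wlap"
      using assms(5) unw.no_loop by (intro eq_matI)
        (auto simp: assms(8,9) n wtd.wlap_def transition_mat_def lap_entry_def nth_eq_iff_index_eq
          deg_nz)
    have sum_deg: "(\<Sum>x\<in>pverts G. complex_of_nat (deg G x)) = 2 * of_nat m"
      using arg_cong[OF unw.sum_deg, of complex_of_nat] by (simp add: assms(4))
    \<comment> \<open>The total weight \<open>2 * m\<close> must be nonzero for 0 to be a simple
      root of the characteristic polynomial of \<open>N\<close>.\<close>
    have "(\<Sum>x\<in>pverts G. deg G x) > 0"
      using deg unw.verts_nonempty pair_finite_verts by (intro sum_pos) auto
    then have "m \<noteq> 0"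
      using unw.sum_deg assms(4) by simp
    then have "complex_of_real (mult_degree_kirchhoff_index G) =
        2 * of_nat m * (\<Sum>\<mu> | eigenvalue N \<mu> \<and> \<mu> \<noteq> 0. of_nat (alg_mult N \<mu>) * (1 / \<mu>))"
      using wtd.sum_reciprocal_nonzero_eigenvalues_wlap unfolding sum_deg
      by (simp add: N mult_degree_kirchhoff_index_def)
    moreover have "\<not> eigenvalue (mat_delete N k k) 0
        \<and> complex_of_real (degree_vertex_resistance G (vs ! k)) =
          (\<Sum>\<mu> | eigenvalue (mat_delete N k k) \<mu>. of_nat (alg_mult (mat_delete N k k) \<mu>) * (1 / \<mu>))"
      if "k < n" for k
      using that wtd.not_eigenvalue_grounded_0[of k] wtd.sum_reciprocal_eigenvalues_grounded[of k]
      by (simp add: N n degree_vertex_resistance_def)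
    ultimately show ?thesis
      by blast
  qed
  show ?thesis
    using part1 part3 part24 by blast
qed

end
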